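(* Let $v\in\mathbb{N}^n$ and let ${}_{\vee}(x)$, ${}_{\vee}(z)$ be two join irreducible elements of the multinomial lattice $\mathcal{L}(v)$. There exists a meet irreducible element $m$ of $\mathcal{L}(v)$ such that ${}_{\vee}(x)\nearrow m$ and $m\searrow {}_{\vee}(z)$ if and only if ${}_{\vee}(x)\,\unlhd^{\bullet}\,{}_{\vee}(z)$.
   Context: $\mathbb{N}$ is the set of non-negative integers. For $v=(v_1,\ldots,v_n)\in\mathbb{N}^n$, $\mathcal{L}(v)$ is the set of words over the alphabet $\{a_1,\ldots,a_n\}$ in which each letter $a_i$ occurs exactly $v_i$ times. It is ordered by the reflexive and transitive closure of the relation $\rightarrow$, where $w\rightarrow u$ iff $w=w_1a_ia_jw_2$ and $u=w_1a_ja_iw_2$ for some words $w_1,w_2$ and some $i<j$. This ordered set is a lattice. An element $j$ of a finite lattice is join irreducible if it has a unique lower cover, denoted $j_\star$; $m$ is meet irreducible if it has a unique upper cover, denoted $m^\star$. For $j$ join irreducible and $m$ meet irreducible: $j\nearrow m$ iff $j\not\le m$ and $j\le m^\star$; $m\searrow j$ iff $j\not\le m$ and $j_\star\le m$. For a vector $x$ with $0\le x\le v$ let $\min_\vee x=\min\{i: x_i<v_i\}$ ($\infty$ if $x=v$) and $\max_\vee x=\max\{i: x_i>0\}$ ($-\infty$ if $x=0$). The join irreducible elements of $\mathcal{L}(v)$ are exactly the words ${}_{\vee}(x)=(a_1^{x_1}\cdots a_n^{x_n})(a_1^{v_1-x_1}\cdots a_n^{v_n-x_n})$ with $0\le x\le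 v$ and $\min_\vee x<\max_\vee x$, and such an $x$ is uniquely determined by the word. The pair $(\min_\vee x,\max_\vee x)$ is the principal plan of ${}_{\vee}(x)$. For join irreducibles ${}_{\vee}(x)$, ${}_{\vee}(z)$ with principal plans $(a,b)$ and $(e,f)$ respectively, ${}_{\vee}(x)\,\unlhd^{\bullet}\,{}_{\vee}(z)$ means: (i) $[e,f]\subseteq[a,b]$ and $z_i=x_i$ for all $i$ with $e<i<f$; (ii) $z_e=x_e-d_e$ where $d_e\in\{0,1\}$ and $d_e=0$ if $e=a$; (iii) $z_f=x_f+d_f$ where $d_f\in\{0,1\}$ and $d_f=0$ if $f=b$. *)

theory Defs
  imports "HOL-Algebra.Lattice" "HOL-Library.Extended"
begin

text \<open>
  The letter \<open>a\<^sub>i\<close> is the natural number \<open>i \<in> {1..n}\<close>. A vector in \<open>\<nat>\<^sup>n\<close> is a function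
  \<^typ>\<open>nat \<Rightarrow> nat\<close> of which only the values on \<open>{1..n}\<close> are ever used.
\<close>

type_synonym word = "nat list"

definition words :: "nat \<Rightarrow> (nat \<Rightarrow> nat) \<Rightarrow> word set" where
  "words n v = {w. set w \<subseteq> {1..n} \<and> (\<forall>i\<in>{1..n}. count_list w i = v i)}"

definition swap_step :: "word \<Rightarrow> word \<Rightarrow> bool" where
  "swap_step w u \<longleftrightarrow>
     (\<exists>w1 w2 i j. i < j \<and> w = w1 @ [i, j] @ w2 \<and> u = w1 @ [j, i] @ w2)"

definition multinomial_lattice :: "nat \<Rightarrow> (nat \<Rightarrow> nat) \<Rightarrow> word gorder" where
  "multinomial_lattice n v = \<lparr>carrier = words n v, eq = (=), le = swap_step\<^sup>*\<^sup>*\<rparr>"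

definition covers :: "('a, 'b) gorder_scheme \<Rightarrow> 'a \<Rightarrow> 'a \<Rightarrow> bool" where
  "covers L y x \<longleftrightarrow> x \<in> carrier L \<and> y \<in> carrier L \<and> x \<sqsubset>\<^bsub>L\<^esub> y \<and>
     \<not> (\<exists>c\<in>carrier L. x \<sqsubset>\<^bsub>L\<^esub> c \<and> c \<sqsubset>\<^bsub>L\<^esub> y)"

definition join_irreducible :: "('a, 'b) gorder_scheme \<Rightarrow> 'a \<Rightarrow> bool" where
  "join_irreducible L j \<longleftrightarrow> j \<in> carrier L \<and> (\<exists>!c. covers L j c)"

definition meet_irreducible :: "('a, 'b) gorder_scheme \<Rightarrow> 'a \<Rightarrow> bool" where
  "meet_irreducible L m \<longleftrightarrow> m \<in> carrier L \<and> (\<exists>!c. covers L c m)"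

text \<open>The next two are meaningful only for join, respectively meet, irreducible arguments.\<close>

definition lower_star :: "('a, 'b) gorder_scheme \<Rightarrow> 'a \<Rightarrow> 'a" where
  "lower_star L j = (THE c. covers L j c)"

definition upper_star :: "('a, 'b) gorder_scheme \<Rightarrow> 'a \<Rightarrow> 'a" where
  "upper_star L m = (THE c. covers L c m)"

definition up_arrow :: "('a, 'b) gorder_scheme \<Rightarrow> 'a \<Rightarrow> 'a \<Rightarrow> bool" where
  "up_arrow L j m \<longleftrightarrow> \<not> j \<sqsubseteq>\<^bsub>L\<^esub> m \<and> j \<sqsubseteq>\<^bsub>L\<^esub> upper_star L m"

definition down_arrow :: "('a, 'b) gorder_scheme \<Rightarrow> 'a \<Rightarrow> 'a \<Rightarrow> bool" where
  "down_arrow L m j \<longleftrightarrow> \<not> j \<sqsubseteq>\<^bsub>L\<^esub> m \<and> lower_star L j \<sqsubseteq>\<^bsub>L\<^esub> m"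

definition sorted_word :: "nat \<Rightarrow> (nat \<Rightarrow> nat) \<Rightarrow> word" where
  "sorted_word n x = concat (map (\<lambda>i. replicate (x i) i) [1..<Suc n])"

definition join_word :: "nat \<Rightarrow> (nat \<Rightarrow> nat) \<Rightarrow> (nat \<Rightarrow> nat) \<Rightarrow> word" where
  "join_word n v x = sorted_word n x @ sorted_word n (\<lambda>i. v i - x i)"

text \<open>
  \<^const>\<open>Pinf\<close> and \<^const>\<open>Minf\<close> are the conventional values of a minimum, respectively a
  maximum, over the empty set.
\<close>

definition min_join :: "nat \<Rightarrow> (nat \<Rightarrow> nat) \<Rightarrow> (nat \<Rightarrow> nat) \<Rightarrow> nat extended" where
  "min_join n v x = (let S = {i\<in>{1..n}. x i < v i} in if S = {} then Pinf else Fin (Min S))"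

definition max_join :: "nat \<Rightarrow> (nat \<Rightarrow> nat) \<Rightarrow> nat extended" where
  "max_join n x = (let S = {i\<in>{1..n}. 0 < x i} in if S = {} then Minf else Fin (Max S))"

definition principal_plan ::
    "nat \<Rightarrow> (nat \<Rightarrow> nat) \<Rightarrow> (nat \<Rightarrow> nat) \<Rightarrow> nat extended \<times> nat extended" where
  "principal_plan n v x = (min_join n v x, max_join n x)"

text \<open>
  The relation is stated on the vectors \<open>x\<close>, \<open>z\<close> indexing the words \<open>join_word n v x\<close>,
  \<open>join_word n v z\<close>: a join irreducible word determines its index. For join irreducible
  words both components of the principal plan are finite. The equation
  \<open>z\<^sub>e = x\<^sub>e - d\<^sub>e\<close> is written additively to avoid truncated subtraction.
\<close>

definition join_rel :: "nat \<Rightarrow> (nat \<Rightarrow> nat) \<Rightarrow> (nat \<Rightarrow> nat) \<Rightarrow> (nat \<Rightarrow> nat) \<Rightarrow> bool" where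
  "join_rel n v x z \<longleftrightarrow>
     (\<exists>a b e f. principal_plan n v x = (Fin a, Fin b) \<and> principal_plan n v z = (Fin e, Fin f) \<and>
        {e..f} \<subseteq> {a..b} \<and> (\<forall>i. e < i \<and> i < f \<longrightarrow> z i = x i) \<and>
        (\<exists>d\<in>{0, 1}. (e = a \<longrightarrow> d = 0) \<and> z e + d = x e) \<and>
        (\<exists>d\<in>{0, 1}. (f = b \<longrightarrow> d = 0) \<and> z f = x f + d))"

end

theory Submission
  imports Defs "HOL-Library.Multiset"
begin

text \<open>
  A word is regarded as a lattice path, and the order is read off from the points that the path
  passes: \<open>u \<le> w\<close> holds iff, for each pair of letters \<open>i < j\<close>, every pair of an \<open>i\<close> and a \<open>j\<close> that is
  inverted in \<open>u\<close> is inverted in \<open>w\<close> (\<open>swap_steps_reaches\<close>, \<open>swap_steps_if_reaches\<close>). Since one swap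
  creates exactly one inversion, covers are swaps, so a word is join irreducible iff it has a single
  descent. Such a word consists of two sorted runs and is therefore a \<^const>\<open>join_word\<close>; its principal
  plan consists of the two letters at the descent. Reversing words is an
  anti-automorphism of the order. Hence the meet irreducible elements are the reversals of join words,
  and \<open>m \<searrow> j\<close> is the same as \<open>rev m \<nearrow> rev j\<close> (\<open>down_arrow_rev\<close>). Both arrows are thus instances of one
  relation between vectors, namely that the join word of \<open>x\<close> and the reversed join word of \<open>y\<close> are
  related by \<open>\<nearrow>\<close>.

  This relation has a simple form. Let \<open>(c, d)\<close> be the principal plan of \<open>y\<close>. The reversed join
  word of \<open>y\<close> has the unique ascent \<open>c d\<close>, with \<open>v\<^sub>i - y\<^sub>i\<close> letters \<open>i\<close> before the border and \<open>y\<^sub>i\<close> after it.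
  The join word of \<open>x\<close> is not below this word iff there are \<open>i < j\<close> such that
  \<open>x\<^sub>i < v\<^sub>i - y\<^sub>i\<close> and \<open>v\<^sub>j - y\<^sub>j < x\<^sub>j\<close>. Swapping the ascent repairs only the pair
  \<open>(c, d)\<close> and gains only one inversion, so \<open>\<nearrow>\<close> says that \<open>(c, d)\<close> is the only violating pair and
  that it fails by the least possible amount. This forces \<open>x = v - y\<close> strictly between \<open>c\<close> and
  \<open>d\<close>, with an offset of one at \<open>c\<close> and at \<open>d\<close> (\<open>unique_crossing\<close>, \<open>up_arrow_rev_iff\<close>).

  Composing the relation from \<open>x\<close> to \<open>y\<close> with that from \<open>y\<close> to \<open>z\<close>, the complements cancel: \<open>z = x\<close>
  strictly inside the plan \<open>(e, f)\<close> of \<open>z\<close>, which is nested in the plan \<open>(c, d)\<close> of \<open>y\<close>, which in turn is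
  nested in the plan \<open>(a, b)\<close> of \<open>x\<close>. At \<open>e\<close> the two offsets cancel if \<open>e = c\<close>, and a
  difference of one remains if \<open>c < e\<close>, which excludes \<open>e = a\<close>; likewise at \<open>f\<close>. Conversely
  the differences at \<open>e\<close> and \<open>f\<close> tell whether to take \<open>c = e\<close> or \<open>c = a\<close>, and \<open>d = f\<close> or \<open>d = b\<close>
  (\<open>intermediate_vector_iff_join_rel\<close>).
\<close>

section \<open>The order in terms of prefixes\<close>

text \<open>
  For \<open>i < j\<close>, this says that the \<open>t\<close>-th \<open>j\<close> precedes the \<open>(s + 1)\<close>-st \<open>i\<close>, that is, that these two
  occurrences are inverted. The formulation by prefixes makes the degenerate cases come out as
  true: if \<open>t = 0\<close> the empty prefix works, and if there are at most \<open>s\<close> letters \<open>i\<close> and at least \<open>t\<close>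
  letters \<open>j\<close> the whole word does.
\<close>

definition reaches :: "word \<Rightarrow> nat \<Rightarrow> nat \<Rightarrow> nat \<Rightarrow> nat \<Rightarrow> bool" where
  "reaches w i j s t \<longleftrightarrow> (\<exists>p r. w = p @ r \<and> count_list p i \<le> s \<and> t \<le> count_list p j)"

lemma reachesI: "w = p @ r \<Longrightarrow> count_list p i \<le> s \<Longrightarrow> t \<le> count_list p j \<Longrightarrow> reaches w i j s t"
  by (auto simp: reaches_def)

lemma reaches_0 [simp]: "reaches w i j s 0"
  by (rule reachesI[of _ "[]"]) auto

lemma reaches_mono: "reaches w i j s t \<Longrightarrow> s \<le> s' \<Longrightarrow> t' \<le> t \<Longrightarrow> reaches w i j s' t'"
  unfolding reaches_def by (blast intro: order_trans)

lemma prefix_of_swap: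
  assumes "w1 @ [a, b] @ w2 = p @ r"
  shows "p = w1 @ [a] \<or> (\<exists>r'. w1 @ [b, a] @ w2 = p @ r') \<or> (\<exists>q. p = w1 @ [a, b] @ q \<and> w2 = q @ r)"
  using assms by (auto simp: append_eq_append_conv2 append_eq_Cons_conv Cons_eq_append_conv)

text \<open>
  The only prefix that a swap of \<open>a < b\<close> destroys is the one ending between the two letters. If
  \<open>j = a\<close>, then \<open>i < a < b\<close>, and the prefix may be extended past both letters without new occurrences
  of \<open>i\<close>; otherwise the \<open>a\<close> at its end does not count for \<open>j\<close> and may be dropped.
\<close>

lemma swap_step_reaches:
  assumes "swap_step w u" "i < j" "reaches w i j s t"
  shows "reaches u i j s t"
proof -
  from assms(1) obtain w1 w2 a b where ab: "a < b" and w: "w = w1 @ [a, b] @ w2"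
    and u: "u = w1 @ [b, a] @ w2" by (auto simp: swap_step_def)
  from assms(3) obtain p r where p: "w = p @ r" "count_list p i \<le> s" "t \<le> count_list p j"
    by (auto simp: reaches_def)
  consider "p = w1 @ [a]" | r' where "u = p @ r'" | q where "p = w1 @ [a, b] @ q" "w2 = q @ r"
    using prefix_of_swap p(1) u w by metis
  then show ?thesis
  proof cases
    case 1
    show ?thesis
    proof (cases "j = a")
      case True
      then show ?thesis using 1 p ab assms(2) u
        by (intro reachesI[of _ "w1 @ [b, a]" w2]) auto
    next
      case False
      then show ?thesis using 1 p u
        by (intro reachesI[of _ "w1" "[b, a] @ w2"]) (auto split: if_splits)
    qed
  next
    case 2
    then show ?thesis using p by (intro reachesI)
  next
    case 3
    then show ?thesis using p u by (intro reachesI[of _ "w1 @ [b, a] @ q" r]) auto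
  qed
qed

lemma swap_steps_reaches:
  assumes "swap_step\<^sup>*\<^sup>* w u" "i < j" "reaches w i j s t"
  shows "reaches u i j s t"
  using assms by (induction) (auto intro: swap_step_reaches)

lemma swap_step_append: "swap_step w u \<Longrightarrow> swap_step (p @ w @ r) (p @ u @ r)"
  unfolding swap_step_def by (metis append.assoc)

lemma swap_steps_append: "swap_step\<^sup>*\<^sup>* w u \<Longrightarrow> swap_step\<^sup>*\<^sup>* (p @ w @ r) (p @ u @ r)"
  by (induction rule: rtranclp_induct) (auto intro: rtranclp.rtrancl_into_rtrancl dest: swap_step_append)

lemma swap_steps_to_front:
  assumes "\<forall>h\<in>set u. h < c"
  shows "swap_step\<^sup>*\<^sup>* (u @ [c]) (c # u)"
  using assms
proof (induction u)
  case (Cons h u)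
  have "swap_step\<^sup>*\<^sup>* ([h] @ (u @ [c]) @ []) ([h] @ (c # u) @ [])"
    using Cons by (intro swap_steps_append) auto
  moreover have "swap_step (h # c # u) (c # h # u)"
    using Cons.prems unfolding swap_step_def by (metis append_Cons append_Nil list.set_intros(1))
  ultimately show ?case by (simp add: rtranclp.rtrancl_into_rtrancl)
qed auto

text \<open>
  Completeness of the inversion criterion, by induction on the target word. Let \<open>c\<close> be its first
  letter. Every letter before the first \<open>c\<close> of \<open>u\<close> is smaller than \<open>c\<close>, because a larger one
  would form an inversion with that \<open>c\<close>, and the target has none with its first letter. Hence this \<open>c\<close>
  can be moved to the front of \<open>u\<close> by swaps. The inversions between the remaining letters do not change,
  so the hypothesis passes to the words without their first \<open>c\<close>.
\<close>

lemma swap_steps_if_reaches: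
  assumes "mset u = mset w"
    and "\<And>i j s t. i < j \<Longrightarrow> reaches u i j s t \<Longrightarrow> reaches w i j s t"
  shows "swap_step\<^sup>*\<^sup>* u w"
  using assms
proof (induction w arbitrary: u)
  case (Cons c w)
  have "c \<in> set u" using Cons.prems(1) by (metis list.set_intros(1) set_mset_mset)
  then obtain u1 u2 where u: "u = u1 @ c # u2" and c: "c \<notin> set u1"
    by (meson split_list_first)
  have small: "h < c" if h: "h \<in> set u1" for h
  proof (rule ccontr)
    assume "\<not> h < c"
    then have "c < h" using c h by (metis linorder_neqE_nat)
    from h obtain p r where p: "u1 = p @ h # r" by (meson split_list)
    have "reaches u c h 0 1"
      using u p c by (intro reachesI[of _ "p @ [h]"]) auto
    then have "reaches (c # w) c h 0 1" using Cons.prems(2) \<open>c < h\<close> by blast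
    then show False by (auto simp: reaches_def Cons_eq_append_conv)
  qed
  have "swap_step\<^sup>*\<^sup>* (u1 @ u2) w"
  proof (rule Cons.IH)
    show "mset (u1 @ u2) = mset w" using Cons.prems(1) u by simp
  next
    fix i j s t :: nat
    assume ij: "i < j" and "reaches (u1 @ u2) i j s t"
    then obtain p r where p: "u1 @ u2 = p @ r" "count_list p i \<le> s" "t \<le> count_list p j"
      by (auto simp: reaches_def)
    then consider "t = 0" | q where "u1 = p @ q" "t > 0" | q where "p = u1 @ q" "u2 = q @ r"
      by (auto simp: append_eq_append_conv2)
    then show "reaches w i j s t"
    proof cases
      case 2
      \<comment> \<open>Since \<open>j\<close> occurs before the first \<open>c\<close>, both \<open>i < j\<close> and \<open>j\<close> are below \<open>c\<close>, so dropping \<open>c\<close>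
          affects neither count.\<close>
      then have "j \<in> set u1" using p(3) by (metis Un_iff count_notin leD set_append)
      then have "i \<noteq> c" "j \<noteq> c" using small[of j] ij by auto
      have "reaches u i j s t" using 2 p u by (intro reachesI[of _ p]) auto
      then have "reaches (c # w) i j s t" using Cons.prems(2) ij by blast
      then show ?thesis using \<open>i \<noteq> c\<close> \<open>j \<noteq> c\<close>
        by (auto simp: reaches_def Cons_eq_append_conv)
    next
      case 3
      \<comment> \<open>Here the prefix extends beyond the removed \<open>c\<close>, which has to be counted on both sides.\<close>
      have "reaches u i j (s + of_bool (i = c)) (t + of_bool (j = c))"
        using 3 p u by (intro reachesI[of _ "u1 @ c # q"]) auto
      then have "reaches (c # w) i j (s + of_bool (i = c)) (t + of_bool (j = c))"
        using Cons.prems(2) ij by blast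
      then obtain p' r' where p': "c # w = p' @ r'" "count_list p' i \<le> s + of_bool (i = c)"
        "t + of_bool (j = c) \<le> count_list p' j" by (auto simp: reaches_def)
      show ?thesis
      proof (cases p')
        case Nil
        then show ?thesis using p' by auto
      next
        case (Cons c' p'')
        then show ?thesis using p' by (intro reachesI[of w p'' r']) (auto split: if_splits)
      qed
    qed auto
  qed
  then have "swap_step\<^sup>*\<^sup>* ([c] @ (u1 @ u2) @ []) ([c] @ w @ [])"
    by (rule swap_steps_append)
  moreover have "swap_step\<^sup>*\<^sup>* ([] @ (u1 @ [c]) @ u2) ([] @ (c # u1) @ u2)"
    using small by (intro swap_steps_append swap_steps_to_front) auto
  ultimately show ?case using u by auto
qed auto

section \<open>Covers\<close>

fun inversions :: "nat list \<Rightarrow> nat" where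
  "inversions [] = 0"
| "inversions (x # xs) = length (filter (\<lambda>y. y < x) xs) + inversions xs"

lemma inversions_swap_step: "swap_step w u \<Longrightarrow> inversions u = Suc (inversions w)"
proof -
  have "i < j \<Longrightarrow> inversions (w1 @ [j, i] @ w2) = Suc (inversions (w1 @ [i, j] @ w2))" for w1 w2 i j
    by (induction w1) auto
  then show "swap_step w u \<Longrightarrow> ?thesis" by (auto simp: swap_step_def)
qed

lemma inversions_swap_steps: "swap_step\<^sup>*\<^sup>* w u \<Longrightarrow> w = u \<or> inversions w < inversions u"
  by (induction rule: rtranclp_induct) (auto dest: inversions_swap_step)

lemma mset_swap_step: "swap_step w u \<Longrightarrow> mset w = mset u"
  by (auto simp: swap_step_def)

lemma words_mset: "mset w = mset u \<Longrightarrow> w \<in> words n v \<longleftrightarrow> u \<in> words n v"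
  unfolding words_def by (auto simp: count_mset[symmetric] dest: mset_eq_setD)

lemma count_list_words:
  assumes "w \<in> words n v"
  shows "count_list w i = (if i \<in> {1..n} then v i else 0)"
proof (cases "i \<in> {1..n}")
  case False
  then have "i \<notin> set w" using assms unfolding words_def by blast
  then show ?thesis using False by (simp only: if_False count_notin not_False_eq_True)
qed (use assms in \<open>simp add: words_def\<close>)

lemma mset_eq_words: "w \<in> words n v \<Longrightarrow> u \<in> words n v \<Longrightarrow> mset w = mset u"
  by (rule multiset_eqI) (simp only: count_mset count_list_words)

text \<open>
  Between a word and the result of one swap there is no room, because every swap raises
  the number of inversions by exactly one.
\<close>

lemma covers_iff:
  "covers (multinomial_lattice n v) u w \<longleftrightarrow> w \<in> words n v \<and> swap_step w u"
proof
  assume cov: "covers (multinomial_lattice n v) u w"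
  then have "swap_step\<^sup>*\<^sup>* w u" "w \<noteq> u" and w: "w \<in> words n v"
    by (auto simp: covers_def multinomial_lattice_def lless_def)
  then obtain c where c: "swap_step w c" "swap_step\<^sup>*\<^sup>* c u"
    by (metis converse_rtranclpE)
  have "c \<in> words n v" using c(1) w by (metis mset_swap_step words_mset)
  moreover have "w \<noteq> c" using c(1) inversions_swap_step by fastforce
  ultimately have "c = u"
    using cov c by (auto simp: covers_def multinomial_lattice_def lless_def)
  then show "w \<in> words n v \<and> swap_step w u" using c w by blast
next
  assume wu: "w \<in> words n v \<and> swap_step w u"
  then have "u \<in> words n v" by (metis mset_swap_step words_mset)
  moreover have inv: "inversions u = Suc (inversions w)" using wu inversions_swap_step by blast
  moreover have False if "swap_step\<^sup>*\<^sup>* w c" "w \<noteq> c" "swap_step\<^sup>*\<^sup>* c u" "c \<noteq> u" for c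
    using that inv by (auto dest!: inversions_swap_steps)
  ultimately show "covers (multinomial_lattice n v) u w"
    using wu by (fastforce simp: covers_def multinomial_lattice_def lless_def)
qed

lemma join_irreducible_swap_step:
  "join_irreducible (multinomial_lattice n v) w \<longleftrightarrow> w \<in> words n v \<and> (\<exists>!u. swap_step u w)"
proof -
  have "covers (multinomial_lattice n v) w u \<longleftrightarrow> swap_step u w" if "w \<in> words n v" for u
    using that by (metis covers_iff mset_swap_step words_mset)
  then show ?thesis by (auto simp: join_irreducible_def multinomial_lattice_def)
qed

lemma meet_irreducible_swap_step:
  "meet_irreducible (multinomial_lattice n v) w \<longleftrightarrow> w \<in> words n v \<and> (\<exists>!u. swap_step w u)"
  by (auto simp: meet_irreducible_def multinomial_lattice_def covers_iff[unfolded multinomial_lattice_def])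

section \<open>Duality by reversal\<close>

lemma swap_step_rev: "swap_step u w \<Longrightarrow> swap_step (rev w) (rev u)"
  unfolding swap_step_def
proof clarify
  fix w1 w2 :: "nat list" and i j :: nat
  assume "i < j"
  then show "\<exists>w1' w2' i' j'. i' < j' \<and> rev (w1 @ [j, i] @ w2) = w1' @ [i', j'] @ w2' \<and>
      rev (w1 @ [i, j] @ w2) = w1' @ [j', i'] @ w2'"
    by (intro exI[of _ "rev w2"] exI[of _ "rev w1"] exI[of _ i] exI[of _ j]) simp
qed

lemma swap_step_rev_iff: "swap_step (rev w) u \<longleftrightarrow> swap_step (rev u) w"
  by (metis swap_step_rev rev_rev_ident)

lemma swap_steps_rev_iff: "swap_step\<^sup>*\<^sup>* (rev w) (rev u) \<longleftrightarrow> swap_step\<^sup>*\<^sup>* u w"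
proof -
  have "swap_step\<^sup>*\<^sup>* (rev w) (rev u)" if "swap_step\<^sup>*\<^sup>* u w" for u w
    using that by induction (auto intro: converse_rtranclp_into_rtranclp dest: swap_step_rev)
  then show ?thesis by (metis rev_rev_ident)
qed

lemma meet_irreducible_rev:
  "meet_irreducible (multinomial_lattice n v) (rev w) \<longleftrightarrow> join_irreducible (multinomial_lattice n v) w"
proof -
  have "(\<exists>!u. swap_step (rev w) u) \<longleftrightarrow> (\<exists>!u. swap_step u w)"
    by (metis swap_step_rev_iff rev_rev_ident)
  then show ?thesis
    by (simp add: meet_irreducible_swap_step join_irreducible_swap_step words_def)
qed

lemma upper_star_eq:
  assumes "meet_irreducible (multinomial_lattice n v) m" "swap_step m u"
  shows "upper_star (multinomial_lattice n v) m = u"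
  unfolding upper_star_def covers_iff
  using assms meet_irreducible_swap_step by (intro the_equality) auto

lemma upper_star_rev:
  assumes "join_irreducible (multinomial_lattice n v) w"
  shows "upper_star (multinomial_lattice n v) (rev w) = rev (lower_star (multinomial_lattice n v) w)"
proof (rule upper_star_eq)
  have "covers (multinomial_lattice n v) w (lower_star (multinomial_lattice n v) w)"
    using assms unfolding join_irreducible_def lower_star_def by (metis theI')
  then show "swap_step (rev w) (rev (lower_star (multinomial_lattice n v) w))"
    by (auto simp: covers_iff swap_step_rev)
qed (use assms meet_irreducible_rev in blast)

text \<open>
  Reversal turns \<open>j\<^sub>\<star> \<le> m\<close> into \<open>rev m \<le> (rev j)\<^sup>\<star>\<close>. It suffices therefore to analyse \<open>\<nearrow>\<close>.
\<close>

lemma down_arrow_rev: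
  assumes "join_irreducible (multinomial_lattice n v) w"
  shows "down_arrow (multinomial_lattice n v) (rev m) w
           \<longleftrightarrow> up_arrow (multinomial_lattice n v) m (rev w)"
  unfolding down_arrow_def up_arrow_def upper_star_rev[OF assms]
  by (simp add: multinomial_lattice_def) (metis swap_steps_rev_iff rev_rev_ident)

section \<open>Words with one descent\<close>

lemma count_sorted_word: "count_list (sorted_word n x) i = (if i \<in> {1..n} then x i else 0)"
proof -
  have "count_list (replicate k a) i = (if a = i then k else 0)" for k a :: nat
    by (induction k) auto
  then show ?thesis unfolding sorted_word_def by (induction n) auto
qed

lemma sorted_sorted_word: "sorted (sorted_word n x)"
  unfolding sorted_word_def by (induction n) (auto simp: sorted_append)

lemma set_sorted_word: "set (sorted_word n x) = {i\<in>{1..n}. 0 < x i}"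
  by (auto simp: sorted_word_def)

lemma sorted_word_eqI:
  assumes "sorted w" "set w \<subseteq> {1..n}" "\<And>i. i \<in> {1..n} \<Longrightarrow> count_list w i = x i"
  shows "sorted_word n x = w"
proof -
  have "mset w = mset (sorted_word n x)"
    using assms by (intro multiset_eqI) (auto simp: count_mset count_sorted_word intro!: count_notin)
  then show ?thesis using assms(1) sorted_sorted_word by (metis properties_for_sort sorted_sort_id)
qed

lemma join_word_in_words:
  assumes "\<forall>i\<in>{1..n}. x i \<le> v i"
  shows "join_word n v x \<in> words n v"
  using assms by (auto simp: words_def join_word_def count_sorted_word set_sorted_word)

lemma sorted_last_iff:
  fixes xs :: "nat list"
  assumes "sorted xs"
  shows "(\<exists>ys. xs = ys @ [b]) \<longleftrightarrow> b \<in> set xs \<and> (\<forall>i\<in>set xs. i \<le> b)"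
  using assms by (cases xs rule: rev_cases) (auto simp: sorted_append intro: order_antisym)

lemma sorted_hd_iff:
  fixes xs :: "nat list"
  assumes "sorted xs"
  shows "(\<exists>ys. xs = a # ys) \<longleftrightarrow> a \<in> set xs \<and> (\<forall>i\<in>set xs. a \<le> i)"
  using assms by (cases xs) (auto intro: order_antisym)

lemma principal_plan_iff:
  "principal_plan n v x = (Fin a, Fin b) \<longleftrightarrow>
     (a \<in> {1..n} \<and> x a < v a \<and> (\<forall>i\<in>{1..n}. x i < v i \<longrightarrow> a \<le> i)) \<and>
     (b \<in> {1..n} \<and> 0 < x b \<and> (\<forall>i\<in>{1..n}. 0 < x i \<longrightarrow> i \<le> b))"
proof -
  have "finite {i\<in>{1..n}. x i < v i}" "finite {i\<in>{1..n}. 0 < x i}" by auto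
  then show ?thesis
    unfolding principal_plan_def min_join_def max_join_def Let_def
    by (auto simp: Min_eq_iff Max_eq_iff Min_in Max_in split: if_splits)
qed

text \<open>
  The principal plan is visible in the join word: its entries are the letters on the two sides of
  the border between the two runs.
\<close>

lemma principal_plan_sorted_word:
  "principal_plan n v x = (Fin a, Fin b) \<longleftrightarrow>
     (\<exists>R. sorted_word n (\<lambda>i. v i - x i) = a # R) \<and> (\<exists>P. sorted_word n x = P @ [b])"
  unfolding sorted_last_iff[OF sorted_sorted_word] sorted_hd_iff[OF sorted_sorted_word]
    principal_plan_iff set_sorted_word
  by auto

lemma descent_if_not_sorted:
  fixes w :: "nat list"
  assumes "\<not> sorted w"
  shows "\<exists>p b a r. w = p @ [b, a] @ r \<and> a < b"
  using assms
proof (induction w)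
  case (Cons c w)
  show ?case
  proof (cases "sorted w")
    case True
    then obtain d w' where "w = d # w'" "d < c" using Cons.prems by (cases w) auto
    then show ?thesis by (metis append_Cons append_Nil)
  next
    case False
    then show ?thesis using Cons.IH by (metis append_Cons)
  qed
qed auto

text \<open>
  Used to show that a word with only one lower cover has only one descent: the two results already
  differ at the left position, where only one of the swaps changes the letter.
\<close>

lemma swap_at_different_positions:
  assumes "p @ [b, a] @ r = q @ [d, c] @ s" "length p < length q" "a \<noteq> b"
  shows "p @ [a, b] @ r \<noteq> q @ [c, d] @ s"
proof
  assume eq: "p @ [a, b] @ r = q @ [c, d] @ s"
  have "b = q ! length p"
    using assms(2) arg_cong[OF assms(1), of "\<lambda>w. w ! length p"] by (simp add: nth_append)
  moreover have "a = q ! length p"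
    using assms(2) arg_cong[OF eq, of "\<lambda>w. w ! length p"] by (simp add: nth_append)
  ultimately show False using assms(3) by simp
qed

text \<open>
  Distinct descents give distinct lower covers, so there is a single descent. It cuts the word into two
  sorted runs, and a sorted word is determined by its letter counts.
\<close>

lemma join_irreducible_is_join_word:
  assumes "join_irreducible (multinomial_lattice n v) w"
  shows "\<exists>x. (\<forall>i\<in>{1..n}. x i \<le> v i) \<and> w = join_word n v x"
proof -
  from assms have ww: "w \<in> words n v" and ex1: "\<exists>!u. swap_step u w"
    by (auto simp: join_irreducible_swap_step)
  then obtain w1 i j w2 where w: "w = w1 @ [j, i] @ w2" and "i < j"
    by (auto simp: swap_step_def)
  have step: "swap_step (p @ [a, b] @ r) w" if "w = p @ [b, a] @ r" "a < b" for p a b r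
    using that by (auto simp: swap_step_def)
  have same: "length p = length w1" if "w = p @ [b, a] @ r" "a < b" for p a b r
  proof -
    have eq: "p @ [a, b] @ r = w1 @ [i, j] @ w2"
      using ex1 step[OF that] step[OF w \<open>i < j\<close>] by blast
    show ?thesis
      using swap_at_different_positions[of p b a r w1 j i w2]
        swap_at_different_positions[of w1 j i w2 p b a r] that w \<open>i < j\<close> eq
      by (metis linorder_neqE_nat less_irrefl)
  qed
  have P: "sorted (w1 @ [j])"
  proof (rule ccontr)
    assume "\<not> ?thesis"
    then obtain p b a r where par: "w1 @ [j] = p @ [b, a] @ r" "a < b"
      using descent_if_not_sorted by blast
    then have "w = p @ [b, a] @ (r @ i # w2)" using w
      by (metis append.assoc append_Cons append_Nil)
    then have "length p = length w1" using same par(2) by blast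
    then show False using arg_cong[OF par(1), of length] by simp
  qed
  have R: "sorted (i # w2)"
  proof (rule ccontr)
    assume "\<not> ?thesis"
    then obtain p b a r where par: "i # w2 = p @ [b, a] @ r" "a < b"
      using descent_if_not_sorted by blast
    then have "w = (w1 @ [j] @ p) @ [b, a] @ r" using w by simp
    then have "length (w1 @ [j] @ p) = length w1" using same par(2) by blast
    then show False by simp
  qed
  define x where "x = count_list (w1 @ [j])"
  have v: "v k = count_list (w1 @ [j]) k + count_list (i # w2) k" if "k \<in> {1..n}" for k
  proof -
    have "v k = count_list w k" using count_list_words[OF ww] that by simp
    then show ?thesis by (simp add: w)
  qed
  have set: "set (w1 @ [j]) \<subseteq> {1..n}" "set (i # w2) \<subseteq> {1..n}"
    using ww w by (auto simp: words_def)
  have "sorted_word n x = w1 @ [j]"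
    using P set by (intro sorted_word_eqI) (auto simp: x_def)
  moreover have "sorted_word n (\<lambda>k. v k - x k) = i # w2"
    using R set by (intro sorted_word_eqI) (use v x_def in auto)
  ultimately have "w = join_word n v x" by (simp add: join_word_def w)
  moreover have "\<forall>k\<in>{1..n}. x k \<le> v k" using v by (auto simp: x_def)
  ultimately show ?thesis by blast
qed

lemma descent_between_sorted:
  assumes "sorted (P @ [b])" "sorted (a # R)" "P @ [b, a] @ R = p @ [d, c] @ r" "c < (d::nat)"
  shows "p = P \<and> d = b \<and> c = a \<and> r = R"
  using assms
  by (auto simp: append_eq_append_conv2 append_eq_Cons_conv Cons_eq_append_conv sorted_append)

lemma join_irreducible_iff_principal_plan:
  assumes "\<forall>i\<in>{1..n}. x i \<le> v i"
  shows "join_irreducible (multinomial_lattice n v) (join_word n v x) \<longleftrightarrow>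
           (\<exists>a b. principal_plan n v x = (Fin a, Fin b) \<and> a < b)"
proof
  assume "join_irreducible (multinomial_lattice n v) (join_word n v x)"
  then obtain p c d r where p: "join_word n v x = p @ [d, c] @ r" "c < d"
    by (auto simp: join_irreducible_swap_step swap_step_def)
  have ns: "\<not> sorted (join_word n v x)" using p by (auto simp: sorted_append)
  then obtain P b where P: "sorted_word n x = P @ [b]"
    using sorted_sorted_word unfolding join_word_def by (metis append_Nil rev_exhaust)
  obtain a R where R: "sorted_word n (\<lambda>i. v i - x i) = a # R"
    using ns sorted_sorted_word unfolding join_word_def by (metis append_Nil2 neq_Nil_conv)
  have "a < b"
    using ns sorted_sorted_word[of n x] sorted_sorted_word[of n "\<lambda>i. v i - x i"]
    unfolding join_word_def P R by (force simp: sorted_append)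
  then show "\<exists>a b. principal_plan n v x = (Fin a, Fin b) \<and> a < b"
    using P R principal_plan_sorted_word by blast
next
  assume "\<exists>a b. principal_plan n v x = (Fin a, Fin b) \<and> a < b"
  then obtain a b P R where "a < b" and P: "sorted_word n x = P @ [b]"
    and R: "sorted_word n (\<lambda>i. v i - x i) = a # R"
    unfolding principal_plan_sorted_word by blast
  have w: "join_word n v x = P @ [b, a] @ R" by (simp add: join_word_def P R)
  have "swap_step u (join_word n v x) \<longleftrightarrow> u = P @ [a, b] @ R" for u
    using descent_between_sorted[of P b a R] sorted_sorted_word[of n x] \<open>a < b\<close>
      sorted_sorted_word[of n "\<lambda>i. v i - x i"]
    unfolding w P R swap_step_def by metis
  then show "join_irreducible (multinomial_lattice n v) (join_word n v x)"
    using join_word_in_words[OF assms] by (auto simp: join_irreducible_swap_step)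
qed

section \<open>The arrow relation\<close>

lemma sorted_prefix_count:
  assumes "sorted (p @ q)" "i < j" "(j::nat) \<in> set p"
  shows "count_list q i = 0"
  using assms by (force simp: sorted_append intro!: count_notin)

text \<open>
  The inversions of a word \<open>P @ R\<close> with sorted runs are those between a letter of \<open>R\<close> and a larger
  letter of \<open>P\<close>. For each pair of letters \<open>i < j\<close> they are all implied by the extremal one, the last \<open>j\<close> of
  \<open>P\<close> against the first \<open>i\<close> of \<open>R\<close>. Hence only one point per pair has to be tested.
\<close>

lemma two_runs_le_iff_reaches:
  assumes P: "sorted P" and R: "sorted R" and m: "mset (P @ R) = mset w"
  shows "swap_step\<^sup>*\<^sup>* (P @ R) w \<longleftrightarrow>
           (\<forall>i j. i < j \<longrightarrow> reaches w i j (count_list P i) (count_list P j))"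
proof
  assume "swap_step\<^sup>*\<^sup>* (P @ R) w"
  moreover have "reaches (P @ R) i j (count_list P i) (count_list P j)" for i j
    by (rule reachesI) auto
  ultimately show "\<forall>i j. i < j \<longrightarrow> reaches w i j (count_list P i) (count_list P j)"
    using swap_steps_reaches by blast
next
  assume H: "\<forall>i j. i < j \<longrightarrow> reaches w i j (count_list P i) (count_list P j)"
  show "swap_step\<^sup>*\<^sup>* (P @ R) w"
  proof (rule swap_steps_if_reaches[OF m])
    fix i j s t :: nat
    assume ij: "i < j" and "reaches (P @ R) i j s t"
    then obtain p r where p: "P @ R = p @ r" "count_list p i \<le> s" "t \<le> count_list p j"
      by (auto simp: reaches_def)
    have tot: "count_list w k = count_list P k + count_list R k" for k
      using arg_cong[OF m, of "\<lambda>M. count M k"] by (simp add: count_mset)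
    have here: "reaches w i j s t" if "count_list P i \<le> s" "t \<le> count_list P j"
      using that H ij reaches_mono by blast
    consider q where "P = p @ q" | q where "p = P @ q" "R = q @ r"
      using p(1) by (auto simp: append_eq_append_conv2)
    then show "reaches w i j s t"
    proof cases
      case 1
      show ?thesis
      proof (cases "j \<in> set p")
        case True
        then have "count_list q i = 0" using sorted_prefix_count P ij 1 by blast
        then show ?thesis using here p 1 by simp
      next
        case False
        then show ?thesis using p(3) by simp
      qed
    next
      case 2
      show ?thesis
      proof (cases "j \<in> set q")
        case True
        then have "count_list r i = 0" using sorted_prefix_count R ij 2 by blast
        then show ?thesis using p 2 tot by (intro reachesI[of w w "[]"]) auto
      next
        case False
        then show ?thesis using here p(2,3) 2 by simp
      qed
    qed
  qed
qed

text \<open>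
  In the word \<open>rev R @ rev P\<close> with two decreasing runs, an \<open>i\<close> precedes a larger \<open>j\<close> iff the \<open>i\<close> is in
  the first run and the \<open>j\<close> in the second. The right-hand side is the negation of this for the
  \<open>(s + 1)\<close>-st \<open>i\<close> and the \<open>t\<close>-th \<open>j\<close>.
\<close>

lemma reaches_rev_two_runs:
  assumes P: "sorted P" and R: "sorted R" and "i < j" and t: "t \<le> count_list (P @ R) j"
  shows "reaches (rev (P @ R)) i j s t \<longleftrightarrow> count_list R i \<le> s \<or> t \<le> count_list R j"
proof
  assume "reaches (rev (P @ R)) i j s t"
  then obtain p r where p: "rev R @ rev P = p @ r" "count_list p i \<le> s" "t \<le> count_list p j"
    by (auto simp: reaches_def)
  then consider q where "rev R = p @ q" | q where "p = rev R @ q"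
    by (auto simp: append_eq_append_conv2)
  then show "count_list R i \<le> s \<or> t \<le> count_list R j"
  proof cases
    case 1
    then have "count_list R j = count_list p j + count_list q j"
      by (metis count_list_append count_list_rev)
    then show ?thesis using p by simp
  next
    case 2
    then show ?thesis using p by simp
  qed
next
  have split: "\<exists>p r. rev xs = p @ r \<and> count_list p i = 0 \<and> count_list p j = count_list xs j"
    if "sorted xs" for xs
  proof (intro exI conjI)
    let ?p = "filter (\<lambda>k. k < j) xs" and ?r = "filter (\<lambda>k. \<not> k < j) xs"
    have "xs = ?p @ ?r" using that
    proof (induction xs)
      case (Cons c xs)
      show ?case
      proof (cases "c < j")
        case False
        then have "filter (\<lambda>k. k < j) (c # xs) = []" "filter (\<lambda>k. \<not> k < j) (c # xs) = c # xs"
          unfolding filter_empty_conv filter_id_conv using Cons.prems by force+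
        then show ?thesis by simp
      qed (use Cons in simp)
    qed simp
    then show "rev xs = rev ?r @ rev ?p" by (metis rev_append)
    show "count_list (rev ?r) i = 0" using \<open>i < j\<close> by (auto intro!: count_notin)
    show "count_list (rev ?r) j = count_list xs j" by (induction xs) auto
  qed
  assume "count_list R i \<le> s \<or> t \<le> count_list R j"
  then show "reaches (rev (P @ R)) i j s t"
  proof
    assume s: "count_list R i \<le> s"
    obtain p r where "rev P = p @ r" "count_list p i = 0" "count_list p j = count_list P j"
      using split[OF P] by blast
    then show ?thesis using s t by (intro reachesI[of _ "rev R @ p" r]) auto
  next
    assume t: "t \<le> count_list R j"
    obtain p r where "rev R = p @ r" "count_list p i = 0" "count_list p j = count_list R j"
      using split[OF R] by blast
    then show ?thesis using t by (intro reachesI[of _ p "r @ rev P"]) auto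
  qed
qed

text \<open>
  The numerical content of \<open>\<nearrow>\<close>. Here \<open>X\<close> counts the letters in the first run of a join word, and \<open>Y\<close>
  those in the first run of a meet irreducible word with ascent \<open>c d\<close>. A pair \<open>i < j\<close> with \<open>X i < Y i\<close> and
  \<open>Y j < X j\<close> violates the order between the two words. If \<open>(c, d)\<close> is the only violating pair, then a
  letter \<open>i\<close> strictly between cannot satisfy \<open>X i < Y i\<close>, as \<open>(i, d)\<close> would violate, nor
  \<open>Y i < X i\<close>, as \<open>(c, i)\<close> would. The hypotheses on \<open>Y\<close> and \<open>X\<close> outside of
  \<open>{c..d}\<close> exclude other violating pairs in the converse direction.
\<close>

lemma unique_crossing:
  fixes X Y :: "nat \<Rightarrow> nat"
  assumes "c < d" "\<And>i. i < c \<Longrightarrow> Y i = 0" "\<And>i. d < i \<Longrightarrow> X i \<le> Y i"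
  shows "\<not> (\<forall>i j. i < j \<longrightarrow> Y i \<le> X i \<or> X j \<le> Y j) \<and>
         (\<forall>i j. i < j \<longrightarrow> Y i \<le> X i \<or> X j \<le> Y j \<or>
            i = c \<and> j = d \<and> Y c \<le> Suc (X c) \<and> X d \<le> Suc (Y d))
     \<longleftrightarrow> Y c = Suc (X c) \<and> X d = Suc (Y d) \<and> (\<forall>i. c < i \<and> i < d \<longrightarrow> X i = Y i)"
    (is "\<not> ?le \<and> ?cov \<longleftrightarrow> ?R")
proof
  assume L: "\<not> ?le \<and> ?cov"
  then obtain i j where "i < j" "X i < Y i" "Y j < X j" by (meson not_le)
  then have cd: "Y c = Suc (X c)" "X d = Suc (Y d)" using L by (metis le_SucE leD Suc_leI order_antisym)+
  have "X i = Y i" if i: "c < i" "i < d" for i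
  proof -
    have "Y i \<le> X i" using L cd i by (metis Suc_n_not_le_n less_irrefl)
    moreover have "X i \<le> Y i" using L cd i by (metis Suc_n_not_le_n less_irrefl)
    ultimately show ?thesis by simp
  qed
  then show ?R using cd by blast
next
  assume R: ?R
  then have eq: "X i = Y i" if "c < i" "i < d" for i using that by blast
  have "i = c \<and> j = d" if "i < j" "X i < Y i" "Y j < X j" for i j
  proof -
    have "c \<le> i" using assms(2)[of i] that by (cases "i < c") auto
    moreover have "j \<le> d" using assms(3)[of j] that by (cases "d < j") auto
    ultimately have "i = c"
      using eq[of i] that by (cases "i = c") auto
    moreover have "j = d"
      using eq[of j] that \<open>i = c\<close> \<open>j \<le> d\<close> by (cases "j = d") auto
    ultimately show ?thesis ..
  qed
  moreover have "\<not> ?le" using R assms(1) by (metis Suc_n_not_le_n)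
  ultimately show "\<not> ?le \<and> ?cov" using R by (metis le_refl not_le)
qed

text \<open>
  The word \<open>m\<close>, the reversed join word of \<open>y\<close>, has its only ascent \<open>c d\<close> at the border of its two
  runs, so its upper cover \<open>m'\<close> is obtained by swapping these letters. Compared with \<open>m\<close>, the
  cover has one new prefix, which ends between the swapped letters.
  It has one \<open>c\<close> less and one \<open>d\<close> more than the first run of \<open>m\<close>, whence the offsets of one.
\<close>

lemma up_arrow_rev_iff:
  assumes x: "\<forall>i\<in>{1..n}. x i \<le> v i" and y: "\<forall>i\<in>{1..n}. y i \<le> v i"
    and plan: "principal_plan n v y = (Fin c, Fin d)" and "c < d"
  shows "up_arrow (multinomial_lattice n v) (join_word n v x) (rev (join_word n v y)) \<longleftrightarrow>
           x c + y c + 1 = v c \<and> x d + y d = v d + 1 \<and> (\<forall>i. c < i \<and> i < d \<longrightarrow> x i + y i = v i)"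
proof -
  obtain P R where P: "sorted_word n y = P @ [d]" and R: "sorted_word n (\<lambda>i. v i - y i) = c # R"
    using plan unfolding principal_plan_sorted_word by blast
  define m where "m = rev (join_word n v y)"
  define m' where "m' = rev R @ [d, c] @ rev P"
  have m: "m = rev R @ [c, d] @ rev P" by (simp add: m_def join_word_def P R)
  have m_rev: "m = rev ((P @ [d]) @ c # R)" by (simp add: m)
  have step: "swap_step m m'" using \<open>c < d\<close> unfolding m m'_def swap_step_def by blast
  have "meet_irreducible (multinomial_lattice n v) m"
    unfolding m_def meet_irreducible_rev using plan \<open>c < d\<close> join_irreducible_iff_principal_plan[OF y] by blast
  then have star: "upper_star (multinomial_lattice n v) m = m'" using step upper_star_eq by blast
  have "m \<in> words n v" using join_word_in_words[OF y] by (simp add: m_def words_def)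
  then have mw: "m \<in> words n v" "m' \<in> words n v" using mset_swap_step[OF step] words_mset by blast+
  have mm: "mset (join_word n v x) = mset m" "mset (join_word n v x) = mset m'"
    using mset_eq_words join_word_in_words[OF x] mw by blast+
  define X where "X = count_list (sorted_word n x)"
  define Y where "Y = count_list (c # R)"
  have Xi: "X i = (if i \<in> {1..n} then x i else 0)" for i by (simp add: X_def count_sorted_word)
  have Yi: "Y i = (if i \<in> {1..n} then v i - y i else 0)" for i
    by (simp add: Y_def R[symmetric] count_sorted_word)
  have Xle: "X j \<le> count_list ((P @ [d]) @ c # R) j" for j
    using x[rule_format, of j] unfolding count_list_append P[symmetric] R[symmetric] Xi
    by (auto simp: count_sorted_word)
  \<comment> \<open>The test points for the join word of \<open>x\<close>, evaluated in \<open>m\<close> and in \<open>m'\<close>.\<close>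
  have reach: "reaches m i j (X i) (X j) \<longleftrightarrow> Y i \<le> X i \<or> X j \<le> Y j" if "i < j" for i j
    unfolding m_rev Y_def
    using sorted_sorted_word[of n y] sorted_sorted_word[of n "\<lambda>i. v i - y i"] that Xle
    unfolding P R by (intro reaches_rev_two_runs) auto
  have reach': "reaches m' i j (X i) (X j) \<longleftrightarrow> Y i \<le> X i \<or> X j \<le> Y j \<or>
            i = c \<and> j = d \<and> Y c \<le> Suc (X c) \<and> X d \<le> Suc (Y d)" if "i < j" for i j
  proof -
    have new: "reaches m' i j s t \<longleftrightarrow> reaches m i j s t \<or>
        count_list (rev R @ [d]) i \<le> s \<and> t \<le> count_list (rev R @ [d]) j" for s t
    proof
      assume "reaches m' i j s t"
      then obtain p r where p: "m' = p @ r" "count_list p i \<le> s" "t \<le> count_list p j"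
        by (auto simp: reaches_def)
      then consider "p = rev R @ [d]" | r' where "m = p @ r'" | q where "p = rev R @ [d, c] @ q" "rev P = q @ r"
        using prefix_of_swap unfolding m m'_def by metis
      then show "reaches m i j s t \<or>
        count_list (rev R @ [d]) i \<le> s \<and> t \<le> count_list (rev R @ [d]) j"
      proof cases
        case 1
        then show ?thesis using p by blast
      next
        case 2
        then show ?thesis using p reachesI by blast
      next
        case 3
        then have "reaches m i j s t" using p m by (intro reachesI[of _ "rev R @ [c, d] @ q" r]) auto
        then show ?thesis ..
      qed
    next
      assume "reaches m i j s t \<or>
        count_list (rev R @ [d]) i \<le> s \<and> t \<le> count_list (rev R @ [d]) j"
      then show "reaches m' i j s t"
        using swap_step_reaches[OF step that] unfolding m'_def
        by (auto intro: reachesI[of _ "rev R @ [d]" "c # rev P"])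
    qed
    show ?thesis
      unfolding new reach[OF that] using that \<open>c < d\<close> by (auto simp: Y_def split: if_splits)
  qed
  have le: "swap_step\<^sup>*\<^sup>* (join_word n v x) w \<longleftrightarrow> (\<forall>i j. i < j \<longrightarrow> reaches w i j (X i) (X j))"
    if "mset (join_word n v x) = mset w" for w
    using that unfolding join_word_def X_def by (intro two_runs_le_iff_reaches sorted_sorted_word)
  have "up_arrow (multinomial_lattice n v) (join_word n v x) m \<longleftrightarrow>
      \<not> swap_step\<^sup>*\<^sup>* (join_word n v x) m \<and> swap_step\<^sup>*\<^sup>* (join_word n v x) m'"
    unfolding up_arrow_def star by (simp add: multinomial_lattice_def)
  also have "\<dots> \<longleftrightarrow> Y c = Suc (X c) \<and> X d = Suc (Y d) \<and> (\<forall>i. c < i \<and> i < d \<longrightarrow> X i = Y i)"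
  proof -
    \<comment> \<open>Both runs of \<open>m\<close> decrease, so the first one has no letter below its last letter \<open>c\<close>, and
        it has all occurrences of each letter above the first letter \<open>d\<close> of the second one.\<close>
    have Y0: "Y i = 0" if "i < c" for i
      using plan that y unfolding principal_plan_iff Yi by (metis diff_is_0_eq not_le)
    have XY: "X i \<le> Y i" if "d < i" for i
    proof (cases "i \<in> {1..n}")
      case True
      then have "y i = 0" using plan that unfolding principal_plan_iff by (meson not_gr0 not_le)
      then show ?thesis using True x by (simp add: Xi Yi)
    qed (simp only: Xi Yi, simp)
    have at_m: "(\<forall>i j. i < j \<longrightarrow> reaches m i j (X i) (X j)) \<longleftrightarrow> (\<forall>i j. i < j \<longrightarrow> Y i \<le> X i \<or> X j \<le> Y j)"
      by (simp only: reach cong: imp_cong)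
    have at_star: "(\<forall>i j. i < j \<longrightarrow> reaches m' i j (X i) (X j)) \<longleftrightarrow> (\<forall>i j. i < j \<longrightarrow> Y i \<le> X i \<or> X j \<le> Y j \<or>
            i = c \<and> j = d \<and> Y c \<le> Suc (X c) \<and> X d \<le> Suc (Y d))"
      by (simp only: reach' cong: imp_cong)
    show ?thesis
      unfolding le[OF mm(1)] le[OF mm(2)] at_m at_star by (rule unique_crossing[OF \<open>c < d\<close> Y0 XY])
  qed
  also have "\<dots> \<longleftrightarrow> x c + y c + 1 = v c \<and> x d + y d = v d + 1 \<and>
      (\<forall>i. c < i \<and> i < d \<longrightarrow> x i + y i = v i)"
  proof -
    have rng: "c \<in> {1..n}" "d \<in> {1..n}" using plan unfolding principal_plan_iff by blast+
    have comp: "X i = x i" "Y i = v i - y i" "x i \<le> v i" "y i \<le> v i" if "c \<le> i" "i \<le> d" for i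
    proof -
      have "i \<in> {1..n}" using rng that by simp
      then show "X i = x i" "Y i = v i - y i" "x i \<le> v i" "y i \<le> v i"
        using x y by (simp_all only: Xi Yi if_True)
    qed
    have "Y c = Suc (X c) \<longleftrightarrow> x c + y c + 1 = v c" using comp[of c] \<open>c < d\<close> by auto
    moreover have "X d = Suc (Y d) \<longleftrightarrow> x d + y d = v d + 1" using comp[of d] \<open>c < d\<close> by auto
    moreover have "X i = Y i \<longleftrightarrow> x i + y i = v i" if "c < i \<and> i < d" for i
      using comp[of i] that by auto
    ultimately show ?thesis by (simp only: cong: imp_cong)
  qed
  finally show ?thesis unfolding m_def .
qed

section \<open>Composing the arrows\<close>

text \<open>
  The vector \<open>y\<close> stands for the meet irreducible word between the two arrows, the reversal of the join
  word of \<open>y\<close>. The sum \<open>x + y\<close> is off by one at the ends of the plan of \<open>y\<close>, and \<open>y + z\<close> at those of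
  the plan of \<open>z\<close>; comparing \<open>x\<close> with \<open>z\<close>, the two deviations cancel where the plans share an end.
\<close>

lemma intermediate_vector_iff_join_rel:
  assumes x: "\<forall>i\<in>{1..n}. x i \<le> v i" and z: "\<forall>i\<in>{1..n}. z i \<le> v i"
    and plan_x: "principal_plan n v x = (Fin a, Fin b)"
    and plan_z: "principal_plan n v z = (Fin e, Fin f)" and "e < f"
  shows "(\<exists>y c d. (\<forall>i\<in>{1..n}. y i \<le> v i) \<and> principal_plan n v y = (Fin c, Fin d) \<and> c < d \<and>
            (x c + y c + 1 = v c \<and> x d + y d = v d + 1 \<and> (\<forall>i. c < i \<and> i < d \<longrightarrow> x i + y i = v i)) \<and>
            (y e + z e + 1 = v e \<and> y f + z f = v f + 1 \<and> (\<forall>i. e < i \<and> i < f \<longrightarrow> y i + z i = v i)))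
          \<longleftrightarrow> join_rel n v x z" (is "?L \<longleftrightarrow> _")
proof
  note px = plan_x[unfolded principal_plan_iff] and pz = plan_z[unfolded principal_plan_iff]
  assume ?L
  then obtain y c d where y: "\<forall>i\<in>{1..n}. y i \<le> v i" and plan: "principal_plan n v y = (Fin c, Fin d)"
    and xy: "x c + y c + 1 = v c" "x d + y d = v d + 1" "\<And>i. c < i \<Longrightarrow> i < d \<Longrightarrow> x i + y i = v i"
    and yz: "y e + z e + 1 = v e" "y f + z f = v f + 1" "\<And>i. e < i \<Longrightarrow> i < f \<Longrightarrow> y i + z i = v i"
    by blast
  note py = plan[unfolded principal_plan_iff]
  have "c \<le> e" using py pz yz(1) by auto
  have "f \<le> d"
  proof -
    have "z f \<le> v f" using z pz by blast
    then have "0 < y f" using yz(2) by simp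
    then show ?thesis using py pz by blast
  qed
  have "a \<le> c" using px py xy(1) by auto
  have "d \<le> b"
  proof -
    have "y d \<le> v d" using y py by blast
    then have "0 < x d" using xy(2) by simp
    then show ?thesis using px py by blast
  qed
  have "z i = x i" if "e < i" "i < f" for i
    using xy(3)[of i] yz(3)[of i] that \<open>c \<le> e\<close> \<open>f \<le> d\<close> by simp
  moreover have "\<exists>\<delta>\<in>{0, 1}. (e = a \<longrightarrow> \<delta> = 0) \<and> z e + \<delta> = x e"
  proof (cases "e = c")
    case True
    then show ?thesis using xy(1) yz(1) by auto
  next
    case False
    then have "x e + y e = v e" using \<open>c \<le> e\<close> \<open>e < f\<close> \<open>f \<le> d\<close> by (intro xy(3)) auto
    then show ?thesis using yz(1) False \<open>c \<le> e\<close> \<open>a \<le> c\<close> by auto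
  qed
  moreover have "\<exists>\<delta>\<in>{0, 1}. (f = b \<longrightarrow> \<delta> = 0) \<and> z f = x f + \<delta>"
  proof (cases "f = d")
    case True
    then show ?thesis using xy(2) yz(2) by auto
  next
    case False
    then have "x f + y f = v f" using \<open>c \<le> e\<close> \<open>e < f\<close> \<open>f \<le> d\<close> by (intro xy(3)) auto
    then show ?thesis using yz(2) False \<open>f \<le> d\<close> \<open>d \<le> b\<close> by auto
  qed
  moreover have "{e..f} \<subseteq> {a..b}" using \<open>c \<le> e\<close> \<open>f \<le> d\<close> \<open>a \<le> c\<close> \<open>d \<le> b\<close> by auto
  ultimately show "join_rel n v x z"
    unfolding join_rel_def plan_x plan_z by blast
next
  note px = plan_x[unfolded principal_plan_iff] and pz = plan_z[unfolded principal_plan_iff]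
  assume "join_rel n v x z"
  then have sub: "{e..f} \<subseteq> {a..b}" and mid: "\<And>i. e < i \<Longrightarrow> i < f \<Longrightarrow> z i = x i"
    and at_e: "z e = x e \<or> e \<noteq> a \<and> z e + 1 = x e"
    and at_f: "z f = x f \<or> f \<noteq> b \<and> z f = x f + 1"
    unfolding join_rel_def plan_x plan_z by auto
  have ab: "a \<le> e" "f \<le> b" using sub \<open>e < f\<close> by auto
  \<comment> \<open>Equality at \<open>e\<close> forces \<open>c = e\<close>. Otherwise \<open>c < e\<close> is needed, together with \<open>x c < v c\<close> for the
    offset at \<open>c\<close>, and \<open>a\<close> is always such a letter; likewise for \<open>d\<close>.\<close>
  define c where "c = (if z e = x e then e else a)"
  define d where "d = (if z f = x f then f else b)"
  \<comment> \<open>Outside of \<open>{c..d}\<close> the vector \<open>y\<close> is extremal, so that its plan is \<open>(c, d)\<close>; inside it is the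
      complement of \<open>x\<close> with the offsets that \<open>\<nearrow>\<close> requires at both ends.\<close>
  define y where "y i = (if i < c then v i else if i = c then v c - x c - 1 else if i < d then v i - x i
    else if i = d then v d + 1 - x d else 0)" for i
  have cd: "a \<le> c" "c \<le> e" "f \<le> d" "d \<le> b" "c < d" using ab \<open>e < f\<close> by (auto simp: c_def d_def)
  have rng: "c \<in> {1..n}" "d \<in> {1..n}" using px cd by auto
  have xc: "x c < v c" using px pz by (auto simp: c_def)
  have xd: "0 < x d" "x d \<le> v d" using px pz x rng by (auto simp: d_def)
  have "\<forall>i\<in>{1..n}. y i \<le> v i" using xd by (auto simp: y_def)
  moreover have "principal_plan n v y = (Fin c, Fin d)"
    unfolding principal_plan_iff using rng xc xd cd by (auto simp: y_def)
  moreover have "x c + y c + 1 = v c" "x d + y d = v d + 1" using xc xd cd by (auto simp: y_def)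
  moreover have xy: "x i + y i = v i" if "c < i" "i < d" for i
    using that x rng by (auto simp: y_def)
  moreover have "y e + z e + 1 = v e"
  proof (cases "z e = x e")
    case True
    then show ?thesis using xc by (simp add: c_def y_def)
  next
    case False
    then have "c < e" using at_e ab by (auto simp: c_def)
    then show ?thesis using xy[of e] False at_e cd \<open>e < f\<close> by simp
  qed
  moreover have "y f + z f = v f + 1"
  proof (cases "z f = x f")
    case True
    then show ?thesis using xd cd \<open>e < f\<close> by (simp add: d_def y_def)
  next
    case False
    then have "f < d" using at_f ab by (auto simp: d_def)
    then show ?thesis using xy[of f] False at_f cd \<open>e < f\<close> by simp
  qed
  moreover have "y i + z i = v i" if "e < i" "i < f" for i
    using xy[of i] mid[of i] that cd by simp
  ultimately show ?L using \<open>c < d\<close> by blast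
qed

theorem proposition3p7:
  fixes n :: nat and v x z :: "nat \<Rightarrow> nat"
  assumes "\<forall>i\<in>{1..n}. x i \<le> v i" and "\<forall>i\<in>{1..n}. z i \<le> v i"
    and "join_irreducible (multinomial_lattice n v) (join_word n v x)"
    and "join_irreducible (multinomial_lattice n v) (join_word n v z)"
  shows "(\<exists>m. meet_irreducible (multinomial_lattice n v) m \<and>
             up_arrow (multinomial_lattice n v) (join_word n v x) m \<and>
             down_arrow (multinomial_lattice n v) m (join_word n v z))
         \<longleftrightarrow> join_rel n v x z"
proof -
  let ?L = "multinomial_lattice n v"
  obtain a b where plan_x: "principal_plan n v x = (Fin a, Fin b)"
    using assms(1,3) join_irreducible_iff_principal_plan by blast
  obtain e f where plan_z: "principal_plan n v z = (Fin e, Fin f)" and "e < f"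
    using assms(2,4) join_irreducible_iff_principal_plan by blast
  have "(\<exists>m. meet_irreducible ?L m \<and> up_arrow ?L (join_word n v x) m \<and> down_arrow ?L m (join_word n v z))
    \<longleftrightarrow> (\<exists>w. meet_irreducible ?L (rev w) \<and> up_arrow ?L (join_word n v x) (rev w) \<and>
          down_arrow ?L (rev w) (join_word n v z))"
    by (metis rev_rev_ident)
  also have "\<dots> \<longleftrightarrow> (\<exists>w. join_irreducible ?L w \<and> up_arrow ?L (join_word n v x) (rev w) \<and>
          up_arrow ?L w (rev (join_word n v z)))"
    unfolding meet_irreducible_rev down_arrow_rev[OF assms(4)] ..
  also have "\<dots> \<longleftrightarrow> (\<exists>y. (\<forall>i\<in>{1..n}. y i \<le> v i) \<and> join_irreducible ?L (join_word n v y) \<and>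
          up_arrow ?L (join_word n v x) (rev (join_word n v y)) \<and>
          up_arrow ?L (join_word n v y) (rev (join_word n v z)))"
    using join_irreducible_is_join_word by blast
  also have "\<dots> \<longleftrightarrow> (\<exists>y c d. (\<forall>i\<in>{1..n}. y i \<le> v i) \<and> principal_plan n v y = (Fin c, Fin d) \<and> c < d \<and>
          up_arrow ?L (join_word n v x) (rev (join_word n v y)) \<and>
          up_arrow ?L (join_word n v y) (rev (join_word n v z)))"
    using join_irreducible_iff_principal_plan by blast
  also have "\<dots> \<longleftrightarrow> join_rel n v x z"
    unfolding intermediate_vector_iff_join_rel[OF assms(1,2) plan_x plan_z \<open>e < f\<close>, symmetric]
    using up_arrow_rev_iff[OF assms(1)] up_arrow_rev_iff[OF _ assms(2) plan_z \<open>e < f\<close>]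
    by (intro ex_cong1) blast
  finally show ?thesis .
qed

end
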